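(* Let $t\ge 2$, let $\mathcal{M}=(E_t,\mathcal{T})$ be a simple oriented matroid on the ground set $E_t=\{1,\ldots,t\}$ with set of topes $\mathcal{T}\subseteq\{1,-1\}^t$, and let $\boldsymbol{R}$ be a symmetric cycle in the tope graph of $\mathcal{M}$ with vertex set $\mathfrak{V}(\boldsymbol{R})$. Let $T$ be a tope of $\mathcal{M}$ such that $T\notin\mathfrak{V}(\boldsymbol{R})$, and write $\boldsymbol{Q}(T,\boldsymbol{R})=\{Q^1,\ldots,Q^{|\boldsymbol{Q}(T,\boldsymbol{R})|}\}$. Then $$\sum_{1\le i<j\le|\boldsymbol{Q}(T,\boldsymbol{R})|}d(Q^i,Q^j)=\frac14\bigl(|\boldsymbol{Q}(T,\boldsymbol{R})|^2-1\bigr)t,$$ $$|\boldsymbol{Q}(T,\boldsymbol{R})|=\sqrt{1+\frac4t\sum_{1\le i<j\le|\boldsymbol{Q}(T,\boldsymbol{R})|}d(Q^i,Q^j)},$$ and moreover $$\sum_{1\le i<j\le|\boldsymbol{Q}(T,\boldsymbol{R})|}d(Q^i,Q^j)=\frac12\bigl(|\boldsymbol{Q}(T,\boldsymbol{R})|+1\bigr)\sum_{Q\in\boldsymbol{Q}(T,\boldsymbol{R})}d(T,Q).$$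
   Context: Topes of an oriented matroid are written as vectors in $\{1,-1\}^t\subset\mathbb{R}^t$ (the signs $+,-$ are replaced by the real numbers $1,-1$). "Simple" means without loops, parallel or antiparallel elements. The tope graph has vertex set $\mathcal{T}$, two topes being adjacent iff they differ in exactly one component; the graph distance $d(T',T'')$ between topes equals the Hamming distance (number of components in which $T'$ and $T''$ differ). A symmetric cycle in the tope graph is a cycle $\boldsymbol{R}=(R^0,R^1,\ldots,R^{2t-1},R^0)$ of length $2t$ (with $2t$ distinct vertices) such that $R^{k+t}=-R^k$ for $0\le k\le t-1$; $\mathfrak{V}(\boldsymbol{R})=\{R^0,\ldots,R^{2t-1}\}$. It is known that for every $T\in\mathcal{T}$ there is a unique inclusion-minimal subset of $\mathfrak{V}(\boldsymbol{R})$ whose elements sum (in $\mathbb{R}^t$) to $T$; this subset is denoted $\boldsymbol{Q}(T,\boldsymbol{R})$. *)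

theory Defs
  imports "HOL-Analysis.Analysis"
begin

text \<open>
  Sign vectors are vectors of \<open>real ^ 'n\<close> with entries in \<open>{-1, 0, 1}\<close>; the ground set is the
  index type \<open>'n\<close>, so that \<open>t = CARD('n)\<close>. An oriented matroid is given by its set of covectors
  (which determines, and is determined by, its set of topes).
\<close>

definition sign_comp :: "real ^ 'n \<Rightarrow> real ^ 'n \<Rightarrow> real ^ 'n" where
  "sign_comp X Y = (\<chi> e. if X $ e \<noteq> 0 then X $ e else Y $ e)"

definition separation :: "real ^ 'n \<Rightarrow> real ^ 'n \<Rightarrow> 'n set" where
  "separation X Y = {e. X $ e \<noteq> 0 \<and> X $ e = - Y $ e}"

definition conformal_le :: "real ^ 'n \<Rightarrow> real ^ 'n \<Rightarrow> bool" where
  "conformal_le X Y \<longleftrightarrow> (\<forall>e. X $ e = 0 \<or> X $ e = Y $ e)"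

definition oriented_matroid :: "(real ^ 'n) set \<Rightarrow> bool" where
  "oriented_matroid L \<longleftrightarrow>
     (\<forall>X\<in>L. \<forall>e. X $ e \<in> {-1, 0, 1}) \<and>
     0 \<in> L \<and>
     (\<forall>X\<in>L. - X \<in> L) \<and>
     (\<forall>X\<in>L. \<forall>Y\<in>L. sign_comp X Y \<in> L) \<and>
     (\<forall>X\<in>L. \<forall>Y\<in>L. \<forall>e\<in>separation X Y.
        \<exists>Z\<in>L. Z $ e = 0 \<and> (\<forall>f. f \<notin> separation X Y \<longrightarrow> Z $ f = sign_comp X Y $ f))"

definition is_loop :: "(real ^ 'n) set \<Rightarrow> 'n \<Rightarrow> bool" where
  "is_loop L e \<longleftrightarrow> (\<forall>X\<in>L. X $ e = 0)"

definition parallel :: "(real ^ 'n) set \<Rightarrow> 'n \<Rightarrow> 'n \<Rightarrow> bool" where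
  "parallel L e f \<longleftrightarrow> (\<forall>X\<in>L. X $ e = X $ f)"

definition antiparallel :: "(real ^ 'n) set \<Rightarrow> 'n \<Rightarrow> 'n \<Rightarrow> bool" where
  "antiparallel L e f \<longleftrightarrow> (\<forall>X\<in>L. X $ e = - X $ f)"

definition simple_oriented_matroid :: "(real ^ 'n) set \<Rightarrow> bool" where
  "simple_oriented_matroid L \<longleftrightarrow>
     oriented_matroid L \<and> (\<forall>e. \<not> is_loop L e) \<and>
     (\<forall>e f. e \<noteq> f \<longrightarrow> \<not> parallel L e f \<and> \<not> antiparallel L e f)"

definition topes :: "(real ^ 'n) set \<Rightarrow> (real ^ 'n) set" where
  "topes L = {T \<in> L. \<forall>Y\<in>L. conformal_le T Y \<longrightarrow> Y = T}"

definition tope_adj :: "(real ^ 'n) set \<Rightarrow> (real ^ 'n) rel" where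
  "tope_adj L = {(A, B). A \<in> topes L \<and> B \<in> topes L \<and> card {e. A $ e \<noteq> B $ e} = 1}"

text \<open>
  Least length of a walk in the tope graph; for a simple oriented matroid this graph is connected,
  so the set of such lengths is nonempty for any two topes.
\<close>

definition tope_dist :: "(real ^ 'n) set \<Rightarrow> real ^ 'n \<Rightarrow> real ^ 'n \<Rightarrow> nat" where
  "tope_dist L A B = (LEAST k. (A, B) \<in> tope_adj L ^^ k)"

text \<open>A cycle \<open>(R 0, \<dots>, R (2t - 1), R 0)\<close>; only the values of \<open>R\<close> below \<open>2t\<close> are relevant.\<close>

definition symmetric_cycle :: "(real ^ 'n) set \<Rightarrow> (nat \<Rightarrow> real ^ 'n) \<Rightarrow> bool" where
  "symmetric_cycle L R \<longleftrightarrow>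
     inj_on R {..<2 * CARD('n)} \<and>
     (\<forall>k<2 * CARD('n). (R k, R (Suc k mod (2 * CARD('n)))) \<in> tope_adj L) \<and>
     (\<forall>k<CARD('n). R (k + CARD('n)) = - R k)"

definition cycle_vertices :: "(nat \<Rightarrow> real ^ 'n) \<Rightarrow> (real ^ 'n) set" where
  "cycle_vertices R = R ` {..<2 * CARD('n)}"

definition minimal_summing_set :: "real ^ 'n \<Rightarrow> (nat \<Rightarrow> real ^ 'n) \<Rightarrow> (real ^ 'n) set \<Rightarrow> bool" where
  "minimal_summing_set T R Q \<longleftrightarrow>
     Q \<subseteq> cycle_vertices R \<and> \<Sum>Q = T \<and> (\<forall>Q'. Q' \<subset> Q \<longrightarrow> \<Sum>Q' \<noteq> T)"

definition decomp :: "real ^ 'n \<Rightarrow> (nat \<Rightarrow> real ^ 'n) \<Rightarrow> (real ^ 'n) set" where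
  "decomp T R = (THE Q. minimal_summing_set T R Q)"

end

(*
  A symmetric cycle flips every coordinate exactly once on its way from R 0 to R t = - R 0.  Listing
  the coordinates in the order in which they are flipped gives linear functionals whose value at a
  vertex of the cycle is 1 at R j, -1 at R (j + t) and 0 elsewhere, and which separate points.  Hence
  a set of vertices with sum T contains R j (resp. R (j + t)) whenever the j-th functional is 1
  (resp. -1) at T, and these vertices alone already have sum T; this is the minimal set.

  The identities come from expanding the inner product of T, written as the sum of its decomposition,
  with itself and with T, because inner products of sign vectors are t - 2 d with d the Hamming
  distance.  That the latter is the distance in the tope graph is seen by choosing, among the topes
  different from A that differ from A only where B does, a tope D for which the set S of differences
  is minimal.  Minimality forces every covector obtained by eliminating an element of S between A
  and D to vanish on all of S, and composing it with a covector that tells two elements of S apart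
  would give a smaller set; so S is a singleton and D is a neighbour of A on the way to B.
*)

theory Submission
  imports Defs
begin

section \<open>Hamming distance and inner products of sign vectors\<close>

definition hamming :: "real ^ 'n \<Rightarrow> real ^ 'n \<Rightarrow> nat" where
  "hamming A B = card {e. A $ e \<noteq> B $ e}"

lemma hamming_commute: "hamming A B = hamming B A"
  unfolding hamming_def by (rule arg_cong[where f = card]) auto

lemma hamming_eq_0_iff: "hamming A B = 0 \<longleftrightarrow> A = B"
  by (auto simp: hamming_def vec_eq_iff)

lemma hamming_triangle: "hamming A C \<le> hamming A B + hamming B C"
proof -
  have "{e. A $ e \<noteq> C $ e} \<subseteq> {e. A $ e \<noteq> B $ e} \<union> {e. B $ e \<noteq> C $ e}"
    by auto
  then have "hamming A C \<le> card ({e. A $ e \<noteq> B $ e} \<union> {e. B $ e \<noteq> C $ e})"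
    unfolding hamming_def by (intro card_mono) auto
  also have "\<dots> \<le> hamming A B + hamming B C"
    unfolding hamming_def by (rule card_Un_le)
  finally show ?thesis .
qed

lemma inner_sign_vectors:
  fixes A B :: "real ^ 'n"
  assumes "\<And>e. A $ e \<in> {-1, 1}" and "\<And>e. B $ e \<in> {-1, 1}"
  shows "A \<bullet> B = real CARD('n) - 2 * real (hamming A B)"
proof -
  have "A \<bullet> B = (\<Sum>e\<in>UNIV. 1 - 2 * (if A $ e \<noteq> B $ e then 1 else 0))"
    unfolding inner_vec_def
  proof (rule sum.cong)
    fix e
    show "A $ e \<bullet> B $ e = 1 - 2 * (if A $ e \<noteq> B $ e then 1 else 0)"
      using assms(1)[of e] assms(2)[of e] by auto
  qed simp
  then show ?thesis
    by (simp add: sum_subtractf hamming_def sum.If_cases flip: sum_distrib_left)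
qed

section \<open>Topes and their distance\<close>

text \<open>A maximal covector absorbs composition with any covector. Since \<open>e\<close> is not
  a loop, some covector is nonzero at \<open>e\<close>, so the tope is nonzero there too.
  Conversely, a covector without zeros conforms only to itself.\<close>

lemma tope_iff:
  assumes "simple_oriented_matroid L"
  shows "A \<in> topes L \<longleftrightarrow> A \<in> L \<and> (\<forall>e. A $ e \<in> {-1, 1})"
proof
  assume A: "A \<in> topes L"
  then have AL: "A \<in> L"
    by (simp add: topes_def)
  have "A $ e \<in> {-1, 1}" for e
  proof -
    obtain X where X: "X \<in> L" "X $ e \<noteq> 0"
      using assms unfolding simple_oriented_matroid_def is_loop_def by blast
    have "sign_comp A X \<in> L"
      using assms AL X by (simp add: simple_oriented_matroid_def oriented_matroid_def)
    moreover have "conformal_le A (sign_comp A X)"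
      by (simp add: conformal_le_def sign_comp_def)
    ultimately have "sign_comp A X = A"
      using A by (simp add: topes_def)
    then have "sign_comp A X $ e = A $ e"
      by simp
    with X have "A $ e \<noteq> 0"
      by (auto simp: sign_comp_def)
    moreover have "A $ e \<in> {-1, 0, 1}"
      using assms AL unfolding simple_oriented_matroid_def oriented_matroid_def by blast
    ultimately show ?thesis
      by auto
  qed
  with AL show "A \<in> L \<and> (\<forall>e. A $ e \<in> {-1, 1})"
    by blast
next
  assume A: "A \<in> L \<and> (\<forall>e. A $ e \<in> {-1, 1})"
  then have "A $ e \<noteq> 0" for e
    by (metis insertE neg_equal_0_iff_equal singletonD zero_neq_one)
  with A show "A \<in> topes L"
    by (auto simp: topes_def conformal_le_def vec_eq_iff)
qed

lemma sign_comp_tope: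
  assumes "simple_oriented_matroid L" and "X \<in> L" and "A \<in> topes L"
  shows "sign_comp X A \<in> topes L"
proof -
  have A: "A \<in> L" "\<And>e. A $ e \<in> {-1, 1}"
    using assms tope_iff by auto
  have "X $ e \<in> {-1, 0, 1}" for e
    using assms unfolding simple_oriented_matroid_def oriented_matroid_def by blast
  moreover have "sign_comp X A \<in> L"
    using assms A by (simp add: simple_oriented_matroid_def oriented_matroid_def)
  ultimately show ?thesis
    using A(2) by (fastforce simp: tope_iff[OF assms(1)] sign_comp_def)
qed

text \<open>The purpose is that \<open>sign_comp X A\<close> flips \<open>A\<close> at one of the
  two elements and keeps it at the other. After reorienting so that \<open>A\<close> is all
  positive, simplicity says that some covector takes different values at \<open>e\<close> and
  \<open>f\<close>.\<close>

lemma separating_covector: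
  assumes som: "simple_oriented_matroid L" and A: "A \<in> topes L" and "e \<noteq> f"
  obtains X g h where "X \<in> L" and "{g, h} = {e, f}" and "X $ g = - A $ g" and "X $ h \<noteq> - A $ h"
proof -
  have Ae: "A $ e \<in> {-1, 1}" and Af: "A $ f \<in> {-1, 1}"
    using som A tope_iff by auto
  obtain X where X: "X \<in> L" "X $ e * A $ e \<noteq> X $ f * A $ f"
  proof (cases "A $ e = A $ f")
    case True
    have "\<not> parallel L e f"
      using som \<open>e \<noteq> f\<close> by (simp add: simple_oriented_matroid_def)
    then obtain X where "X \<in> L" "X $ e \<noteq> X $ f"
      by (auto simp: parallel_def)
    with True Af that show ?thesis
      by fastforce
  next
    case False
    have "\<not> antiparallel L e f"
      using som \<open>e \<noteq> f\<close> by (simp add: simple_oriented_matroid_def)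
    then obtain X where "X \<in> L" "X $ e \<noteq> - X $ f"
      by (auto simp: antiparallel_def)
    with False Ae Af that show ?thesis
      by fastforce
  qed
  have mX: "- X \<in> L" and Xe: "X $ e \<in> {-1, 0, 1}" and Xf: "X $ f \<in> {-1, 0, 1}"
    using som X unfolding simple_oriented_matroid_def oriented_matroid_def by blast+
  \<comment> \<open>Of two different values in {-1, 0, 1} at least one is nonzero; passing to
    \<open>- X\<close> if necessary makes it -1 relative to \<open>A\<close>, while the other is not
    -1.\<close>
  consider "X $ e = - A $ e" "X $ f \<noteq> - A $ f" | "X $ f = - A $ f" "X $ e \<noteq> - A $ e"
    | "- X $ e = - A $ e" "- X $ f \<noteq> - A $ f" | "- X $ f = - A $ f" "- X $ e \<noteq> - A $ e"
    using X(2) Xe Xf Ae Af by fastforce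
  then show ?thesis
  proof cases
    case 1 with X that[of X e f] show ?thesis by simp
  next
    case 2 with X that[of X f e] show ?thesis by auto
  next
    case 3 with mX that[of "- X" e f] show ?thesis by simp
  next
    case 4 with mX that[of "- X" f e] show ?thesis by auto
  qed
qed

lemma adjacent_tope_towards:
  fixes A B :: "real ^ 'n"
  assumes som: "simple_oriented_matroid L"
    and A: "A \<in> topes L" and B: "B \<in> topes L" and "A \<noteq> B"
  obtains C where "(A, C) \<in> tope_adj L" and "{e. A $ e \<noteq> C $ e} \<subseteq> {e. A $ e \<noteq> B $ e}"
proof -
  define S where "S C = {e. A $ e \<noteq> C $ e}" for C :: "real ^ 'n"
  define P where "P C \<longleftrightarrow> C \<in> topes L \<and> C \<noteq> A \<and> S C \<subseteq> S B" for C
  have "P B"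
    using B \<open>A \<noteq> B\<close> by (auto simp: P_def)
  then obtain D where PD: "P D" and Dmin: "\<And>C. P C \<Longrightarrow> card (S D) \<le> card (S C)"
    using ex_has_least_nat[of P B "card \<circ> S"] by auto
  have D: "D \<in> topes L" "D \<noteq> A" "S D \<subseteq> S B"
    using PD by (auto simp: P_def)
  have As: "A $ e \<in> {-1, 1}" and Ds: "D $ e \<in> {-1, 1}" for e
    using tope_iff[OF som] A D by blast+
  have D0: "D $ e \<noteq> 0" for e
    using Ds[of e] by auto
  have min: "S C = S D" if "C \<in> topes L" "C \<noteq> A" "S C \<subseteq> S D" for C
  proof -
    have "P C"
      using that D by (auto simp: P_def)
    then show ?thesis
      using Dmin card_subset_eq[OF _ that(3)] card_mono[OF _ that(3)] by (simp add: le_antisym)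
  qed
  have sub: "S C \<subseteq> S D" if "\<And>g. A $ g = D $ g \<Longrightarrow> C $ g = A $ g" for C
    unfolding S_def using that by (metis (mono_tags, lifting) mem_Collect_eq subsetI)
  have "card (S D) = 1"
  proof (rule ccontr)
    assume "card (S D) \<noteq> 1"
    moreover have "S D \<noteq> {}"
      using not_sym[OF D(2)] by (auto simp: S_def vec_eq_iff)
    ultimately obtain e f where ef: "e \<in> S D" "f \<in> S D" "e \<noteq> f"
      by (metis all_not_in_conv is_singletonI' is_singleton_altdef)
    have "A $ g \<noteq> 0 \<and> A $ g = - D $ g \<longleftrightarrow> A $ g \<noteq> D $ g" for g
      using As[of g] Ds[of g] by auto
    then have sep: "separation A D = S D"
      by (simp add: separation_def S_def)
    have "A \<in> L" "D \<in> L"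
      using A D by (auto simp: topes_def)
    \<comment> \<open>Eliminating \<open>e\<close> between the topes \<open>A\<close> and
      \<open>D\<close> gives a covector that agrees with \<open>A\<close> off
      \<open>S D\<close>.\<close>
    then have "\<exists>Z\<in>L. Z $ e = 0 \<and> (\<forall>f. f \<notin> separation A D \<longrightarrow> Z $ f = sign_comp A D $ f)"
      using som ef(1) sep unfolding simple_oriented_matroid_def oriented_matroid_def by blast
    moreover have "sign_comp A D $ g = A $ g" for g
      using As[of g] by (auto simp: sign_comp_def)
    ultimately obtain Z where Z: "Z \<in> L" "Z $ e = 0"
        and Zoff: "\<And>g. A $ g = D $ g \<Longrightarrow> Z $ g = A $ g"
      using sep by (auto simp: S_def)
    \<comment> \<open>As \<open>Z\<close> vanishes at \<open>e\<close>, this composition agrees with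
      \<open>A\<close> there; if it were not \<open>A\<close>, its difference set would lie in
      \<open>S D\<close> and miss \<open>e\<close>, against minimality.\<close>
    have "sign_comp Z A = A"
    proof (rule ccontr)
      assume "sign_comp Z A \<noteq> A"
      moreover have "S (sign_comp Z A) \<subseteq> S D"
        by (rule sub) (simp add: Zoff sign_comp_def)
      ultimately have "S (sign_comp Z A) = S D"
        using min sign_comp_tope[OF som Z(1) A] by blast
      moreover have "e \<notin> S (sign_comp Z A)"
        using Z(2) by (simp add: S_def sign_comp_def)
      ultimately show False
        using ef(1) by simp
    qed
    \<comment> \<open>Here the entry at \<open>e\<close> is that of \<open>D\<close>, so the
      composition is not \<open>A\<close> and minimality applies.\<close>
    moreover have "S (sign_comp Z D) = S D"
    proof (rule min[OF sign_comp_tope[OF som Z(1) D(1)]])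
      have "sign_comp Z D $ e \<noteq> A $ e"
        using Z(2) ef(1) by (simp add: sign_comp_def S_def)
      then show "sign_comp Z D \<noteq> A"
        by metis
      show "S (sign_comp Z D) \<subseteq> S D"
        by (rule sub) (simp add: Zoff sign_comp_def)
    qed
    \<comment> \<open>A nonzero \<open>Z $ g\<close> would equal \<open>A $ g\<close> by the first
      equation and differ from \<open>A $ g\<close> by the second.\<close>
    ultimately have Zon: "Z $ g = 0" if "g \<in> S D" for g
      using that by (auto simp: S_def sign_comp_def vec_eq_iff set_eq_iff) metis
    obtain X g h where X: "X \<in> L" "{g, h} = {e, f}" "X $ g = - A $ g" "X $ h \<noteq> - A $ h"
      using separating_covector[OF som A ef(3)] by blast
    have gh: "g \<in> S D" "h \<in> S D"
      using X(2) ef by (auto simp: doubleton_eq_iff)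
    \<comment> \<open>Off \<open>S D\<close> the covector \<open>Z\<close> is nonzero and equal to
      \<open>A\<close>; on \<open>S D\<close> it vanishes, so there \<open>W\<close> is
      \<open>sign_comp X A\<close>. Hence \<open>W\<close> flips \<open>g\<close> but not
      \<open>h\<close>, against minimality.\<close>
    define W where "W = sign_comp Z (sign_comp X A)"
    have "W \<in> topes L"
      unfolding W_def using som X Z A by (intro sign_comp_tope) auto
    moreover have "W $ g \<noteq> A $ g"
      using As[of g] Zon[OF gh(1)] X by (auto simp: W_def sign_comp_def)
    then have "W \<noteq> A"
      by metis
    moreover have "S W \<subseteq> S D"
      by (rule sub) (simp add: Zoff D0 W_def sign_comp_def)
    ultimately have "h \<in> S W"
      using min gh by blast
    moreover have "X $ h \<in> {-1, 0, 1}"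
      using som X unfolding simple_oriented_matroid_def oriented_matroid_def by blast
    ultimately show False
      using As[of h] Zon[OF gh(2)] X by (auto simp: S_def W_def sign_comp_def split: if_splits)
  qed
  then have "(A, D) \<in> tope_adj L"
    using A D by (simp add: tope_adj_def S_def)
  then show ?thesis
    using that D(3) by (simp add: S_def)
qed

lemma hamming_le_walk_length:
  assumes "(A, B) \<in> tope_adj L ^^ k"
  shows "hamming A B \<le> k"
  using assms
proof (induction k arbitrary: B)
  case 0
  then show ?case
    by (simp add: hamming_eq_0_iff)
next
  case (Suc k)
  then obtain C where C: "(A, C) \<in> tope_adj L ^^ k" "(C, B) \<in> tope_adj L"
    by auto
  then have "hamming C B = 1"
    by (simp add: tope_adj_def hamming_def)
  with Suc.IH[OF C(1)] hamming_triangle[of A B C] show ?case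
    by simp
qed

lemma walk_of_hamming_length:
  assumes "simple_oriented_matroid L" and "A \<in> topes L" and "B \<in> topes L"
  shows "(A, B) \<in> tope_adj L ^^ hamming A B"
  using assms(2)
proof (induction "hamming A B" arbitrary: A)
  case 0
  then show ?case
    by (metis hamming_eq_0_iff pair_in_Id_conv relpow.simps(1))
next
  case (Suc k)
  then have "A \<noteq> B"
    by (metis hamming_eq_0_iff nat.distinct(1))
  then obtain C where C: "(A, C) \<in> tope_adj L"
      and sub: "{e. A $ e \<noteq> C $ e} \<subseteq> {e. A $ e \<noteq> B $ e}"
    using adjacent_tope_towards[OF assms(1) Suc.prems assms(3)] by blast
  have Ct: "C \<in> topes L" and "card {e. A $ e \<noteq> C $ e} = 1"
    using C by (auto simp: tope_adj_def)
  then obtain e where e: "{e. A $ e \<noteq> C $ e} = {e}"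
    by (meson card_1_singletonE)
  have "A $ e \<in> {-1, 1}" "B $ e \<in> {-1, 1}" "C $ e \<in> {-1, 1}"
    using tope_iff[OF assms(1)] Suc.prems assms(3) Ct by blast+
  \<comment> \<open>With only two possible signs, \<open>B\<close> and \<open>C\<close> agree
    wherever both differ from \<open>A\<close>.\<close>
  with e sub have "C $ e = B $ e" "A $ e \<noteq> B $ e"
    by auto
  moreover have "A $ g = C $ g" if "g \<noteq> e" for g
    using e that by blast
  ultimately have "A $ g \<noteq> B $ g \<longleftrightarrow> g = e \<or> C $ g \<noteq> B $ g" for g
    by (cases "g = e") auto
  then have "{g. A $ g \<noteq> B $ g} = insert e {g. C $ g \<noteq> B $ g}" "e \<notin> {g. C $ g \<noteq> B $ g}"
    using \<open>C $ e = B $ e\<close> by auto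
  then have "hamming A B = Suc (hamming C B)"
    by (simp add: hamming_def)
  with Suc Ct C show ?case
    by (metis nat.inject relpow_Suc_I2)
qed

lemma tope_dist_eq_hamming:
  assumes "simple_oriented_matroid L" and "A \<in> topes L" and "B \<in> topes L"
  shows "tope_dist L A B = hamming A B"
  unfolding tope_dist_def
proof (rule Least_equality)
  show "(A, B) \<in> tope_adj L ^^ hamming A B"
    by (rule walk_of_hamming_length[OF assms])
qed (rule hamming_le_walk_length)

section \<open>The decomposition along a symmetric cycle\<close>

lemma symmetric_cycle_topes:
  assumes "symmetric_cycle L R" and "P \<in> cycle_vertices R"
  shows "P \<in> topes L"
  using assms by (auto simp: symmetric_cycle_def cycle_vertices_def tope_adj_def)

text \<open>\<open>c j\<close> is the coordinate flipped between \<open>R j\<close> and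
  \<open>R (Suc j)\<close>. Relative to \<open>R 0\<close> its sign is therefore + up to index j, -
  on the next t vertices, and + again afterwards.\<close>

lemma symmetric_cycle_flip_order:
  fixes R :: "nat \<Rightarrow> real ^ 'n"
  assumes som: "simple_oriented_matroid L" and cyc: "symmetric_cycle L R"
  obtains c :: "nat \<Rightarrow> 'n" where "bij_betw c {..<CARD('n)} UNIV"
    and "\<And>j k. j < CARD('n) \<Longrightarrow> k < 2 * CARD('n) \<Longrightarrow>
           R k $ c j * R 0 $ c j = (if k \<le> j \<or> j + CARD('n) < k then 1 else -1)"
proof -
  let ?t = "CARD('n)"
  have t0: "0 < ?t"
    by simp
  have sgn: "R k $ e \<in> {-1, 1}" if "k < 2 * ?t" for k e
    using that tope_iff[OF som, of "R k"] symmetric_cycle_topes[OF cyc, of "R k"]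
    by (auto simp: cycle_vertices_def)
  have neg: "R (k + ?t) = - R k" if "k < ?t" for k
    using cyc that by (simp add: symmetric_cycle_def)
  have "\<exists>e. {e. R k $ e \<noteq> R (Suc k) $ e} = {e}" if "k < ?t" for k
  proof -
    have "Suc k < 2 * ?t"
      using that t0 by linarith
    then have "(R k, R (Suc k)) \<in> tope_adj L"
      using cyc that unfolding symmetric_cycle_def by (metis Suc_lessD mod_less)
    then show ?thesis
      by (auto simp: tope_adj_def card_1_singleton_iff)
  qed
  then obtain c where c: "\<And>k. k < ?t \<Longrightarrow> {e. R k $ e \<noteq> R (Suc k) $ e} = {c k}"
    by metis
  \<comment> \<open>A coordinate never flipped in the first t steps would agree in
    \<open>R 0\<close> and \<open>R t = - R 0\<close>. So t flips cover t coordinates, each exactly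
    once.\<close>
  have "\<exists>k<?t. c k = e" for e
  proof (rule ccontr)
    assume "\<not> (\<exists>k<?t. c k = e)"
    then have const: "R k $ e = R (Suc k) $ e" if "k < ?t" for k
      using c[OF that] that by (metis (mono_tags, lifting) mem_Collect_eq singletonD)
    have "R k $ e = R 0 $ e" if "k \<le> ?t" for k
      using that by (induction k) (auto simp: const[symmetric])
    from this[of ?t] have "R (0 + ?t) $ e = R 0 $ e"
      by simp
    then show False
      using neg[OF t0] sgn[of 0 e] by auto
  qed
  then have surj: "c ` {..<?t} = UNIV"
    by (metis UNIV_eq_I image_eqI lessThan_iff)
  then have inj: "inj_on c {..<?t}"
    by (intro eq_card_imp_inj_on) auto
  have half: "R k $ c j * R 0 $ c j = (if k \<le> j then 1 else -1)" if "j < ?t" "k \<le> ?t" for j k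
    using that(2)
  proof (induction k)
    case 0
    then show ?case
      using sgn[of 0 "c j"] by auto
  next
    case (Suc k)
    then have k: "k < ?t" and IH: "R k $ c j * R 0 $ c j = (if k \<le> j then 1 else -1)"
      by auto
    show ?case
    proof (cases "k = j")
      case True
      have "Suc k < 2 * ?t"
        using k t0 by linarith
      then have "R k $ c j \<in> {-1, 1}" "R (Suc k) $ c j \<in> {-1, 1}"
        using sgn by auto
      moreover have "R k $ c j \<noteq> R (Suc k) $ c j"
        using c[OF k] True by auto
      ultimately have "R (Suc k) $ c j = - R k $ c j"
        by auto
      with IH True show ?thesis
        by simp
    next
      case False
      then have "c j \<noteq> c k"
        using inj k that(1) by (auto dest: inj_onD)
      then have "R k $ c j = R (Suc k) $ c j"
        using c[OF k] by blast
      with IH False show ?thesis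
        by auto
    qed
  qed
  show ?thesis
  proof (rule that)
    show "bij_betw c {..<?t} UNIV"
      using inj surj by (simp add: bij_betw_def)
  next
    fix j k
    assume j: "j < ?t" and k: "k < 2 * ?t"
    show "R k $ c j * R 0 $ c j = (if k \<le> j \<or> j + ?t < k then 1 else -1)"
    proof (cases "k \<le> ?t")
      case True
      with half[OF j True] show ?thesis
        by auto
    next
      case False
      \<comment> \<open>The second half of the cycle is the negative of the first; index t was
        already treated, so \<open>i\<close> is positive.\<close>
      then obtain i where i: "k = i + ?t" "0 < i" "i < ?t"
        using k by (metis add.commute add_less_cancel_right less_imp_add_positive mult_2 not_le)
      then have "R k $ c j * R 0 $ c j = - (R i $ c j * R 0 $ c j)"
        using neg[of i] by simp
      also have "\<dots> = - (if i \<le> j then 1 else -1)"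
        using half[OF j, of i] i by simp
      finally show ?thesis
        using i j by simp
    qed
  qed
qed

text \<open>The functionals \<open>\<phi> j\<close> with j < t are the coordinates with respect to
  the basis \<open>R 0\<close>, ..., \<open>R (t - 1)\<close>; the vertex
  \<open>R (j + t) = - R j\<close> accounts for the value -1.\<close>

lemma symmetric_cycle_coordinates:
  fixes R :: "nat \<Rightarrow> real ^ 'n"
  assumes som: "simple_oriented_matroid L" and cyc: "symmetric_cycle L R"
  obtains \<phi> :: "nat \<Rightarrow> real ^ 'n \<Rightarrow> real" where "\<And>j. linear (\<phi> j)"
    and "\<And>x y. (\<And>j. j < CARD('n) \<Longrightarrow> \<phi> j x = \<phi> j y) \<Longrightarrow> x = y"
    and "\<And>j x. (\<And>e. x $ e \<in> {-1, 1}) \<Longrightarrow> \<phi> j x \<in> {-1, 0, 1}"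
    and "\<And>j P. j < CARD('n) \<Longrightarrow> P \<in> cycle_vertices R \<Longrightarrow>
           \<phi> j P = (if P = R j then 1 else 0) - (if P = R (j + CARD('n)) then 1 else 0)"
proof -
  let ?t = "CARD('n)"
  have t0: "0 < ?t"
    by simp
  obtain c where bij: "bij_betw c {..<?t} (UNIV :: 'n set)"
    and c: "\<And>j k. j < ?t \<Longrightarrow> k < 2 * ?t \<Longrightarrow>
           R k $ c j * R 0 $ c j = (if k \<le> j \<or> j + ?t < k then 1 else -1)"
    using symmetric_cycle_flip_order[OF assms] by blast
  have R0: "R 0 $ e \<in> {-1, 1}" for e
    using tope_iff[OF som, of "R 0"] symmetric_cycle_topes[OF cyc, of "R 0"]
    by (auto simp: cycle_vertices_def)
  define s where "s j x = x $ c j * R 0 $ c j" for j x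
  \<comment> \<open>Along the cycle, \<open>s j\<close> and \<open>s (j - 1)\<close> differ only at
    indices j and j + t, by 2 and -2, hence the half. For j = 0 the predecessor of
    \<open>s 0\<close> is \<open>- s (t - 1)\<close>, by antipodality, which turns the difference
    into a sum.\<close>
  define \<phi> where "\<phi> j x = (if j = 0 then s 0 x + s (?t - 1) x else s j x - s (j - 1) x) / 2"
    for j x
  have s_sign: "s j x \<in> {-1, 1}" if "\<And>e. x $ e \<in> {-1, 1}" for j x
    using that[of "c j"] R0[of "c j"] by (auto simp: s_def)
  show ?thesis
  proof (rule that)
    show "linear (\<phi> j)" for j
      by (rule linearI) (auto simp: \<phi>_def s_def field_simps)
  next
    fix x y
    assume eq: "\<And>j. j < ?t \<Longrightarrow> \<phi> j x = \<phi> j y"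
    have step: "s j x - s j y = s 0 x - s 0 y" if "j < ?t" for j
      using that
    proof (induction j)
      case (Suc j)
      with eq[of "Suc j"] show ?case
        by (simp add: \<phi>_def)
    qed simp
    \<comment> \<open>The difference between \<open>x\<close> and \<open>y\<close> is the same for
      all \<open>s j\<close>; the plus sign in \<open>\<phi> 0\<close> makes it equal to its own
      negative.\<close>
    have "s 0 x - s 0 y = 0"
      using step[of "?t - 1"] eq[of 0] by (simp add: \<phi>_def)
    with step have s_eq: "s j x = s j y" if "j < ?t" for j
      using that by simp
    show "x = y"
      unfolding vec_eq_iff
    proof
      fix e
      obtain j where "j < ?t" "e = c j"
        using bij by (metis UNIV_I bij_betw_def imageE lessThan_iff)
      with s_eq[of j] R0[of e] show "x $ e = y $ e"
        by (auto simp: s_def)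
    qed
  next
    fix j and x :: "real ^ 'n"
    assume "\<And>e. x $ e \<in> {-1, 1}"
    from s_sign[OF this, of j] s_sign[OF this, of "j - 1"] s_sign[OF this, of 0]
      s_sign[OF this, of "?t - 1"]
    show "\<phi> j x \<in> {-1, 0, 1}"
      by (auto simp: \<phi>_def)
  next
    fix j P
    assume j: "j < ?t" and "P \<in> cycle_vertices R"
    then obtain k where k: "k < 2 * ?t" "P = R k"
      by (auto simp: cycle_vertices_def)
    have "inj_on R {..<2 * ?t}"
      using cyc by (simp add: symmetric_cycle_def)
    then have R_eq: "R k = R i \<longleftrightarrow> k = i" if "i < 2 * ?t" for i
      using that k(1) by (auto dest: inj_onD)
    have s_R: "s i P = (if k \<le> i \<or> i + ?t < k then 1 else -1)" if "i < ?t" for i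
      using c[OF that k(1)] k(2) by (simp add: s_def)
    have "\<phi> j P = (if k = j then 1 else 0) - (if k = j + ?t then 1 else 0)"
    proof (cases "j = 0")
      case True
      have "s 0 P + s (?t - 1) P = (if k = 0 then 2 else 0) - (if k = ?t then 2 else 0)"
        using s_R[OF t0] s_R[of "?t - 1"] k(1) t0 by (auto split: if_splits)
      with True show ?thesis
        by (auto simp: \<phi>_def split: if_splits)
    next
      case False
      then have "s j P - s (j - 1) P = (if k = j then 2 else 0) - (if k = j + ?t then 2 else 0)"
        using s_R[OF j] s_R[of "j - 1"] k(1) j by (auto split: if_splits)
      with False show ?thesis
        by (auto simp: \<phi>_def split: if_splits)
    qed
    with j show "\<phi> j P = (if P = R j then 1 else 0) - (if P = R (j + ?t) then 1 else 0)"
      by (simp add: k(2) R_eq)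
  qed
qed

text \<open>This makes the description operator in \<open>decomp\<close> meaningful.\<close>

lemma minimal_summing_set_exists_unique:
  fixes R :: "nat \<Rightarrow> real ^ 'n"
  assumes som: "simple_oriented_matroid L" and cyc: "symmetric_cycle L R"
    and T: "\<And>e. T $ e \<in> {-1, 1}"
  shows "\<exists>!Q. minimal_summing_set T R Q"
proof -
  let ?t = "CARD('n)"
  obtain \<phi> :: "nat \<Rightarrow> real ^ 'n \<Rightarrow> real" where lin: "\<And>j. linear (\<phi> j)"
    and sep: "\<And>x y. (\<And>j. j < ?t \<Longrightarrow> \<phi> j x = \<phi> j y) \<Longrightarrow> x = y"
    and \<phi>_sign: "\<And>j x. (\<And>e. x $ e \<in> {-1, 1}) \<Longrightarrow> \<phi> j x \<in> {-1, 0, 1}"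
    and \<phi>R: "\<And>j P. j < ?t \<Longrightarrow> P \<in> cycle_vertices R \<Longrightarrow>
           \<phi> j P = (if P = R j then 1 else 0) - (if P = R (j + ?t) then 1 else 0)"
  proof (rule symmetric_cycle_coordinates[OF som cyc], goal_cases)
    case (1 \<phi>)
    show ?case
      by (rule 1(1)) (fact 1)+
  qed
  have \<phi>_sum: "\<phi> j (\<Sum>A) = (if R j \<in> A then 1 else 0) - (if R (j + ?t) \<in> A then 1 else 0)"
    if "j < ?t" "A \<subseteq> cycle_vertices R" for j A
  proof -
    have fin: "finite A"
      using that(2) finite_subset by (auto simp: cycle_vertices_def)
    have "\<phi> j (\<Sum>A) = (\<Sum>P\<in>A. \<phi> j P)"
      using linear_sum[OF lin, of j "\<lambda>P. P" A] by simp
    also have "\<dots> = (\<Sum>P\<in>A. (if P = R j then 1 else 0) - (if P = R (j + ?t) then 1 else 0))"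
      using that by (intro sum.cong \<phi>R) auto
    finally show ?thesis
      using fin by (simp add: sum_subtractf sum.delta)
  qed
  define M where "M = {R j | j. j < ?t \<and> \<phi> j T = 1} \<union> {R (j + ?t) | j. j < ?t \<and> \<phi> j T = -1}"
  have M_sub: "M \<subseteq> cycle_vertices R"
    by (auto simp: M_def cycle_vertices_def)
  \<comment> \<open>The value 1 (or -1) of \<open>\<phi> j\<close> at a sum arises only if the set
    contains \<open>R j\<close> (or \<open>R (j + t)\<close>) and not its antipode; the value 0
    means neither or both.\<close>
  have M_least: "M \<subseteq> A" if "A \<subseteq> cycle_vertices R" "\<Sum>A = T" for A
    using \<phi>_sum[OF _ that(1)] that(2) by (fastforce simp: M_def split: if_splits)
  have inj: "inj_on R {..<2 * ?t}"
    using cyc by (simp add: symmetric_cycle_def)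
  have M1: "R j \<in> M \<longleftrightarrow> \<phi> j T = 1" and M2: "R (j + ?t) \<in> M \<longleftrightarrow> \<phi> j T = -1" if "j < ?t" for j
  proof -
    have "R j = R i \<longleftrightarrow> j = i" "R j \<noteq> R (i + ?t)" "R (j + ?t) = R (i + ?t) \<longleftrightarrow> j = i"
      "R (j + ?t) \<noteq> R i" if "i < ?t" for i
      using that \<open>j < ?t\<close> inj_on_eq_iff[OF inj, of j i] inj_on_eq_iff[OF inj, of j "i + ?t"]
        inj_on_eq_iff[OF inj, of "j + ?t" i] inj_on_eq_iff[OF inj, of "j + ?t" "i + ?t"]
      by auto
    with that show "R j \<in> M \<longleftrightarrow> \<phi> j T = 1" "R (j + ?t) \<in> M \<longleftrightarrow> \<phi> j T = -1"
      unfolding M_def by blast+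
  qed
  have "\<Sum>M = T"
  proof (rule sep)
    fix j
    assume j: "j < ?t"
    show "\<phi> j (\<Sum>M) = \<phi> j T"
      using \<phi>_sign[OF T, of j] by (auto simp: \<phi>_sum[OF j M_sub] M1[OF j] M2[OF j])
  qed
  \<comment> \<open>\<open>M\<close> has sum \<open>T\<close> and lies inside every set of vertices
    with that sum, so it is minimal and no other such set is.\<close>
  with M_sub M_least show ?thesis
    unfolding minimal_summing_set_def by (intro ex1I[of _ M]) blast+
qed

lemma decomp_sum:
  assumes "simple_oriented_matroid L" and "symmetric_cycle L R" and "\<And>e. T $ e \<in> {-1, 1}"
  shows "decomp T R \<subseteq> cycle_vertices R" and "\<Sum>(decomp T R) = T"
proof -
  have "minimal_summing_set T R (decomp T R)"
    unfolding decomp_def by (rule theI'[OF minimal_summing_set_exists_unique[OF assms]])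
  then show "decomp T R \<subseteq> cycle_vertices R" and "\<Sum>(decomp T R) = T"
    unfolding minimal_summing_set_def by blast+
qed

section \<open>Sums over pairs of summands\<close>

lemma sum_square_split:
  fixes f :: "nat \<Rightarrow> nat \<Rightarrow> real"
  assumes "\<And>i j. f i j = f j i"
  shows "(\<Sum>i=1..m. \<Sum>j=1..m. f i j)
    = (\<Sum>i=1..m. f i i) + 2 * (\<Sum>(i, j)\<in>{(i, j). 1 \<le> i \<and> i < j \<and> j \<le> m}. f i j)"
proof -
  let ?U = "{(i, j). 1 \<le> i \<and> i < j \<and> j \<le> m}"
  let ?D = "(\<lambda>i. (i, i)) ` {1..m}"
  have fin: "finite ?U"
    by (rule finite_subset[of _ "{1..m} \<times> {1..m}"]) auto
  have "(\<Sum>i=1..m. \<Sum>j=1..m. f i j) = (\<Sum>(i, j)\<in>{1..m} \<times> {1..m}. f i j)"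
    by (simp add: sum.cartesian_product)
  \<comment> \<open>The square of indices splits into the diagonal, the strict upper triangle and
    its mirror image.\<close>
  also have "{1..m} \<times> {1..m} = ?D \<union> (?U \<union> prod.swap ` ?U)"
    by (auto simp: image_iff)
  also have "(\<Sum>(i, j)\<in>\<dots>. f i j)
      = (\<Sum>(i, j)\<in>?D. f i j) + ((\<Sum>(i, j)\<in>?U. f i j) + (\<Sum>(i, j)\<in>prod.swap ` ?U. f i j))"
    using fin by (subst sum.union_disjoint, simp, simp, force, subst sum.union_disjoint) auto
  also have "(\<Sum>(i, j)\<in>?D. f i j) = (\<Sum>i=1..m. f i i)"
    by (subst sum.reindex) (auto simp: inj_on_def)
  also have "(\<Sum>(i, j)\<in>prod.swap ` ?U. f i j) = (\<Sum>(i, j)\<in>?U. f i j)"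
    using assms by (subst sum.reindex) (auto simp: inj_on_def intro!: sum.cong)
  finally show ?thesis
    by simp
qed

text \<open>Both are evaluations of \<open>T \<bullet> T = t\<close>. With S the sum over pairs and
  D the sum of the distances to \<open>T\<close>, expanding both factors gives
  \<open>m^2 * t - 4 * S\<close>, and expanding one factor gives
  \<open>m * t - 2 * D\<close>.\<close>

lemma sum_hamming_sign_vectors:
  fixes Q :: "nat \<Rightarrow> real ^ 'n"
  assumes Q: "\<And>i e. i \<in> {1..m} \<Longrightarrow> Q i $ e \<in> {-1, 1}"
    and T: "\<And>e. T $ e \<in> {-1, 1}" and sum: "(\<Sum>i=1..m. Q i) = T"
  shows "4 * (\<Sum>(i, j)\<in>{(i, j). 1 \<le> i \<and> i < j \<and> j \<le> m}. real (hamming (Q i) (Q j)))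
      = (real m ^ 2 - 1) * real CARD('n)"
    and "2 * (\<Sum>i=1..m. real (hamming T (Q i))) = (real m - 1) * real CARD('n)"
proof -
  let ?t = "real CARD('n)"
  have TT: "T \<bullet> T = ?t"
    using inner_sign_vectors[of T T] T by (simp add: hamming_eq_0_iff[THEN iffD2])
  have "T \<bullet> T = (\<Sum>i=1..m. Q i) \<bullet> (\<Sum>j=1..m. Q j)"
    by (simp only: sum)
  also have "\<dots> = (\<Sum>i=1..m. \<Sum>j=1..m. Q i \<bullet> Q j)"
    by (simp add: inner_sum_left inner_sum_right) (rule sum.swap)
  also have "\<dots> = (\<Sum>i=1..m. \<Sum>j=1..m. ?t - 2 * real (hamming (Q i) (Q j)))"
    using Q by (intro sum.cong inner_sign_vectors) auto
  also have "\<dots> = real m ^ 2 * ?t - 2 * (\<Sum>i=1..m. \<Sum>j=1..m. real (hamming (Q i) (Q j)))"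
    by (simp add: sum_subtractf power2_eq_square flip: sum_distrib_left)
  also have "(\<Sum>i=1..m. \<Sum>j=1..m. real (hamming (Q i) (Q j)))
      = 2 * (\<Sum>(i, j)\<in>{(i, j). 1 \<le> i \<and> i < j \<and> j \<le> m}. real (hamming (Q i) (Q j)))"
    by (subst sum_square_split)
      (simp_all add: hamming_commute hamming_eq_0_iff[THEN iffD2])
  finally show "4 * (\<Sum>(i, j)\<in>{(i, j). 1 \<le> i \<and> i < j \<and> j \<le> m}. real (hamming (Q i) (Q j)))
      = (real m ^ 2 - 1) * ?t"
    using TT by (simp add: algebra_simps)
  have "?t = T \<bullet> (\<Sum>i=1..m. Q i)"
    by (simp only: sum TT)
  also have "\<dots> = (\<Sum>i=1..m. T \<bullet> Q i)"
    by (simp add: inner_sum_right)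
  also have "\<dots> = (\<Sum>i=1..m. ?t - 2 * real (hamming T (Q i)))"
    using Q T by (intro sum.cong inner_sign_vectors) auto
  also have "\<dots> = real m * ?t - 2 * (\<Sum>i=1..m. real (hamming T (Q i)))"
    by (simp add: sum_subtractf flip: sum_distrib_left)
  finally show "2 * (\<Sum>i=1..m. real (hamming T (Q i))) = (real m - 1) * ?t"
    by (simp add: algebra_simps)
qed

theorem mainTheorem4:
  fixes L :: "(real ^ 'n) set" and R :: "nat \<Rightarrow> real ^ 'n" and T :: "real ^ 'n"
    and Q :: "nat \<Rightarrow> real ^ 'n"
  assumes "CARD('n) \<ge> 2"
    and "simple_oriented_matroid L"
    and "symmetric_cycle L R"
    and "T \<in> topes L" and "T \<notin> cycle_vertices R"
    and "bij_betw Q {1..card (decomp T R)} (decomp T R)"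
  shows
    "real (\<Sum>(i, j)\<in>{(i, j). 1 \<le> i \<and> i < j \<and> j \<le> card (decomp T R)}. tope_dist L (Q i) (Q j))
       = 1 / 4 * (real (card (decomp T R)) ^ 2 - 1) * real CARD('n)
     \<and>
     real (card (decomp T R))
       = sqrt (1 + 4 / real CARD('n) *
           real (\<Sum>(i, j)\<in>{(i, j). 1 \<le> i \<and> i < j \<and> j \<le> card (decomp T R)}. tope_dist L (Q i) (Q j)))
     \<and>
     real (\<Sum>(i, j)\<in>{(i, j). 1 \<le> i \<and> i < j \<and> j \<le> card (decomp T R)}. tope_dist L (Q i) (Q j))
       = 1 / 2 * (real (card (decomp T R)) + 1) * real (\<Sum>P\<in>decomp T R. tope_dist L T P)"
proof -
  let ?m = "card (decomp T R)"
  let ?t = "real CARD('n)"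
  let ?U = "{(i, j). 1 \<le> i \<and> i < j \<and> j \<le> ?m}"
  let ?S = "real (\<Sum>(i, j)\<in>?U. tope_dist L (Q i) (Q j))"
  let ?D = "real (\<Sum>P\<in>decomp T R. tope_dist L T P)"
  note som = assms(2) and cyc = assms(3) and bij = assms(6)
  have T: "T $ e \<in> {-1, 1}" for e
    using tope_iff[OF som] assms(4) by blast
  note dec = decomp_sum[OF som cyc T]
  have Qt: "Q i \<in> topes L" if "i \<in> {1..?m}" for i
    using symmetric_cycle_topes[OF cyc] dec(1) bij_betwE[OF bij] that by blast
  then have Q: "Q i $ e \<in> {-1, 1}" if "i \<in> {1..?m}" for i e
    using that tope_iff[OF som] by blast
  have "(\<Sum>i=1..?m. Q i) = T"
    using sum.reindex_bij_betw[OF bij, of "\<lambda>P. P"] dec(2) by simp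
  note sums = sum_hamming_sign_vectors[OF Q T this]
  \<comment> \<open>All vectors involved are topes, so the graph distance may be replaced by the
    Hamming distance.\<close>
  have "?S = (\<Sum>(i, j)\<in>?U. real (hamming (Q i) (Q j)))"
    unfolding of_nat_sum by (intro sum.cong) (auto simp: tope_dist_eq_hamming[OF som Qt Qt])
  with sums(1) have S: "4 * ?S = (real ?m ^ 2 - 1) * ?t"
    by simp
  have "?D = (\<Sum>i=1..?m. real (tope_dist L T (Q i)))"
    using sum.reindex_bij_betw[OF bij, of "\<lambda>P. real (tope_dist L T P)"] by simp
  also have "\<dots> = (\<Sum>i=1..?m. real (hamming T (Q i)))"
    by (intro sum.cong) (auto simp: tope_dist_eq_hamming[OF som assms(4) Qt])
  finally have D: "2 * ?D = (real ?m - 1) * ?t"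
    using sums(2) by simp
  have "1 + 4 / ?t * ?S = real ?m ^ 2"
    using S by (simp add: field_simps)
  then have "real ?m = sqrt (1 + 4 / ?t * ?S)"
    by simp
  moreover have "?S = 1 / 4 * (real ?m ^ 2 - 1) * ?t"
    using S by simp
  moreover have "?S = 1 / 2 * (real ?m + 1) * ?D"
  proof -
    \<comment> \<open>Factor \<open>m^2 - 1\<close> as \<open>(m + 1) * (m - 1)\<close> and
      recognise \<open>(m - 1) * t\<close> as twice the sum of the distances to
      \<open>T\<close>.\<close>
    have "4 * ?S = (real ?m + 1) * (2 * ?D)"
      unfolding S D by (simp add: algebra_simps power2_eq_square)
    then show ?thesis
      by simp
  qed
  ultimately show ?thesis
    by blast
qed

end
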